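(* Let $q$ be a prime power and $n$ a positive integer coprime to $q$. (1) Let $\gamma\in\mathbb{Z}/n\mathbb{Z}$ with $\tau=|c_{n/q}(\gamma)|$, and let $\Sigma(\tau;\omega_\gamma)$ be the set of divisors of $\tau$ that are divisible by $\omega_\gamma$. Then the map $\varphi_{c_{n/q}(\gamma)}:\Sigma(\tau;\omega_\gamma)\to\mathcal{MER}(c_{n/q}(\gamma))$, $t\mapsto\big(c_{n/q}(\gamma)=\bigsqcup_{j=0}^{t-1}c_{n/q^t}(\gamma q^j)\big)$, is a bijection, and for $t_1,t_2\in\Sigma(\tau;\omega_\gamma)$ we have $t_1\mid t_2$ if and only if $\varphi_{c_{n/q}(\gamma)}(t_2)\le\varphi_{c_{n/q}(\gamma)}(t_1)$. (2) Let $\omega=2\,\mathrm{ord}_{\mathrm{rad}(n)}(q)$ if $q^{\mathrm{ord}_{\mathrm{rad}(n)}(q)}\equiv3\pmod4$ and $8\mid n$, and $\omega=\mathrm{ord}_{\mathrm{rad}(n)}(q)$ otherwise; let $\Sigma(\mathrm{ord}_n(q);\omega)$ be the set of divisors of $\mathrm{ord}_n(q)$ divisible by $\omega$. Then the map $\varphi_{n/q}:\Sigma(\mathrm{ord}_n(q);\omega)\to\mathcal{MER}_{n/q}$, $t\mapsto\big(c_{n/q}(\gamma)=\bigsqcup_{j=0}^{\gcd(t,\tau_\gamma)-1}c_{n/q^t}(\gamma q^j)\big)_{c_{n/q}(\gamma)\in\mathcal{C}_{n/q}}$, is a bijection, and for $t_1,t_2\in\Sigma(\mathrm{ord}_n(q);\omega)$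 we have $t_1\mid t_2$ if and only if $\varphi_{n/q}(t_2)\le\varphi_{n/q}(t_1)$.
   Context: For $N$ coprime to $n$ (e.g. $N=q^t$) and $\gamma\in\mathbb{Z}/n\mathbb{Z}$, $c_{n/N}(\gamma)=\{\gamma,\gamma N,\dots,\gamma N^{\sigma-1}\}\subseteq\mathbb{Z}/n\mathbb{Z}$ with $\sigma$ least positive such that $\gamma N^\sigma\equiv\gamma\pmod n$; $\tau_\gamma=|c_{n/q}(\gamma)|$; $\mathcal{C}_{n/q}$ is the set of all $q$-cyclotomic cosets modulo $n$. For every positive integer $t$, with $t'=\gcd(t,\tau_\gamma)$, one has the $q^t$-cyclotomic decomposition $c_{n/q}(\gamma)=\bigsqcup_{j=0}^{t'-1}c_{n/q^t}(\gamma q^j)$. A subset $E\subseteq c_{n/q}(\gamma)$ with $|E|=\tau_E$ is an equal-difference subset if $\tau_E\mid n$ and $E=\{e,e+\frac n{\tau_E},\dots,e+(\tau_E-1)\frac n{\tau_E}\}$ in $\mathbb{Z}/n\mathbb{Z}$ for some $e\in E$; an equal-difference decomposition is a partition into disjoint equal-difference subsets. For two such decompositions $\bigsqcup_{i\in I}E_i$ and $\bigsqcup_{j\in J}E'_j$, write $\bigsqcup_{j\in J}E'_j\le\bigsqcup_{i\in I}E_i$ (the first is finer) if $J=\bigsqcup_{i\in I}J_i$ with $E_i=\bigsqcup_{j\in J_i}E'_j$ for all $i$. $\mathcal{MER}(c_{n/q}(\gamma))$ (multiple equal-difference representations) is the set of equal-difference decompositions of $c_{n/q}(\gamma)$ that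 are $q^t$-cyclotomic decompositions for some $t\ge1$. $\mathcal{MER}_{n/q}$ is the set of tuples $\big(c_{n/q}(\gamma)=\bigsqcup_{j=0}^{\gcd(t,\tau_\gamma)-1}c_{n/q^t}(\gamma q^j)\big)_{c_{n/q}(\gamma)\in\mathcal{C}_{n/q}}$ for positive integers $t$ such that each component is a multiple equal-difference representation, ordered componentwise by $\le$. Also $n_\gamma=n/\gcd(\gamma,n)$, $\mathrm{rad}(m)$ is the product of distinct primes dividing $m$, $\mathrm{ord}_m(q)$ is the order of $q$ modulo $m$, and $\omega_\gamma=2\,\mathrm{ord}_{\mathrm{rad}(n_\gamma)}(q)$ if $q^{\mathrm{ord}_{\mathrm{rad}(n_\gamma)}(q)}\equiv3\pmod4$ and $8\mid n_\gamma$, $\omega_\gamma=\mathrm{ord}_{\mathrm{rad}(n_\gamma)}(q)$ otherwise. *)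

theory Defs
  imports "HOL-Number_Theory.Number_Theory" "HOL-Library.Disjoint_Sets" "HOL-Library.FuncSet"
begin

text \<open>
  Residue classes modulo \<open>n\<close> are represented by the natural numbers below \<open>n\<close>;
  all arithmetic in \<open>\<int>/n\<int>\<close> is reduced by \<open>mod n\<close>.
\<close>

definition coset_period :: "nat \<Rightarrow> nat \<Rightarrow> nat \<Rightarrow> nat" where
  "coset_period n N \<gamma> = (LEAST s. 0 < s \<and> [\<gamma> * N ^ s = \<gamma>] (mod n))"

definition cyc_coset :: "nat \<Rightarrow> nat \<Rightarrow> nat \<Rightarrow> nat set" where
  "cyc_coset n N \<gamma> = (\<lambda>k. \<gamma> * N ^ k mod n) ` {..<coset_period n N \<gamma>}"

definition cyc_cosets :: "nat \<Rightarrow> nat \<Rightarrow> nat set set" where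
  "cyc_cosets n q = cyc_coset n q ` {..<n}"

definition tau :: "nat \<Rightarrow> nat \<Rightarrow> nat \<Rightarrow> nat" where
  "tau n q \<gamma> = card (cyc_coset n q \<gamma>)"

text \<open>A decomposition of a set is represented by the set of its parts.\<close>

definition cyc_decomp :: "nat \<Rightarrow> nat \<Rightarrow> nat \<Rightarrow> nat \<Rightarrow> nat set set" where
  "cyc_decomp n q t \<gamma> =
     (\<lambda>j. cyc_coset n (q ^ t) (\<gamma> * q ^ j mod n)) ` {..<gcd t (tau n q \<gamma>)}"

definition equal_diff_subset :: "nat \<Rightarrow> nat set \<Rightarrow> nat set \<Rightarrow> bool" where
  "equal_diff_subset n C E \<longleftrightarrow> E \<subseteq> C \<and> card E dvd n \<and>
     (\<exists>e\<in>E. E = (\<lambda>i. (e + i * (n div card E)) mod n) ` {..<card E})"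

definition equal_diff_decomp :: "nat \<Rightarrow> nat set \<Rightarrow> nat set set \<Rightarrow> bool" where
  "equal_diff_decomp n C D \<longleftrightarrow> partition_on C D \<and> (\<forall>E\<in>D. equal_diff_subset n C E)"

text \<open>\<open>finer D' D\<close>: the parts of \<open>D'\<close> can be grouped into disjoint families \<open>J E\<close>, one for
  each part \<open>E\<close> of \<open>D\<close>, such that \<open>E\<close> is the union of \<open>J E\<close>. The unions are automatically
  disjoint when \<open>D'\<close> is a partition.\<close>

definition finer :: "nat set set \<Rightarrow> nat set set \<Rightarrow> bool" where
  "finer D' D \<longleftrightarrow> (\<exists>J. D' = (\<Union>E\<in>D. J E) \<and> disjoint_family_on J D \<and> (\<forall>E\<in>D. E = \<Union>(J E)))"

definition MER :: "nat \<Rightarrow> nat \<Rightarrow> nat \<Rightarrow> nat set set set" where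
  "MER n q \<gamma> = {D. equal_diff_decomp n (cyc_coset n q \<gamma>) D \<and> (\<exists>t\<ge>1. D = cyc_decomp n q t \<gamma>)}"

text \<open>Tuples indexed by the cosets are extensional functions. The chosen representative
  is immaterial, see \<open>cyc_decomp_tuple_coset\<close> below.\<close>

definition cyc_decomp_tuple :: "nat \<Rightarrow> nat \<Rightarrow> nat \<Rightarrow> nat set \<Rightarrow> nat set set" where
  "cyc_decomp_tuple n q t = (\<lambda>C\<in>cyc_cosets n q. cyc_decomp n q t (SOME \<gamma>. \<gamma> \<in> C))"

definition MER_tuples :: "nat \<Rightarrow> nat \<Rightarrow> (nat set \<Rightarrow> nat set set) set" where
  "MER_tuples n q = {F. (\<exists>t\<ge>1. F = cyc_decomp_tuple n q t) \<and>
     (\<forall>\<gamma><n. F (cyc_coset n q \<gamma>) \<in> MER n q \<gamma>)}"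

definition finer_tuple ::
    "nat \<Rightarrow> nat \<Rightarrow> (nat set \<Rightarrow> nat set set) \<Rightarrow> (nat set \<Rightarrow> nat set set) \<Rightarrow> bool" where
  "finer_tuple n q F' F \<longleftrightarrow> (\<forall>C\<in>cyc_cosets n q. finer (F' C) (F C))"

definition rad :: "nat \<Rightarrow> nat" where
  "rad m = \<Prod>(prime_factors m)"

definition omega :: "nat \<Rightarrow> nat \<Rightarrow> nat" where
  "omega m q = (if [q ^ ord (rad m) q = 3] (mod 4) \<and> 8 dvd m
                then 2 * ord (rad m) q else ord (rad m) q)"

definition Sigma_div :: "nat \<Rightarrow> nat \<Rightarrow> nat set" where
  "Sigma_div \<tau> \<omega> = {t. t dvd \<tau> \<and> \<omega> dvd t}"

lemma period_ex:
  fixes n N \<gamma> :: nat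
  assumes "0 < n" "coprime n N"
  shows "\<exists>s>0. [\<gamma> * N ^ s = \<gamma>] (mod n)"
proof -
  have "[\<gamma> * N ^ ord n N = \<gamma> * 1] (mod n)" using ord_works[of N n] by (intro cong_mult cong_refl) auto
  moreover have "0 < ord n N" using assms ord_eq_0[of n N] by auto
  ultimately show ?thesis by (intro exI[of _ "ord n N"]) (simp del: ord_gt_0_iff)
qed

lemma cong_cancel_power:
  assumes "coprime n N" "[a * N ^ i = b * N ^ i] (mod n)"
  shows "[a = b] (mod (n::nat))"
  using assms by (metis cong_mult_rcancel_nat coprime_power_right_iff coprime_commute)

lemma power_cong_iff:
  fixes n N \<gamma> :: nat
  assumes "0 < n" "coprime n N"
  defines "s \<equiv> coset_period n N \<gamma>"
  shows "0 < s" "[\<gamma> * N ^ i = \<gamma> * N ^ j] (mod n) \<longleftrightarrow> [i = j] (mod s)"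
proof -
  have s: "0 < s \<and> [\<gamma> * N ^ s = \<gamma>] (mod n)"
    unfolding s_def coset_period_def by (rule LeastI_ex) (use period_ex[OF assms(1,2)] in blast)
  thus "0 < s" ..
  have mult: "[\<gamma> * N ^ (k + s * m) = \<gamma> * N ^ k] (mod n)" for k m
  proof (induction m)
    case (Suc m)
    have "[(\<gamma> * N ^ s) * N ^ (k + s * m) = \<gamma> * N ^ (k + s * m)] (mod n)"
      using s by (intro cong_mult cong_refl) auto
    also have "(\<gamma> * N ^ s) * N ^ (k + s * m) = \<gamma> * N ^ (k + s * Suc m)"
      by (simp add: power_add mult_ac)
    finally show ?case using Suc cong_trans by blast
  qed auto
  have red: "[\<gamma> * N ^ k = \<gamma> * N ^ (k mod s)] (mod n)" for k
    using mult[of "k mod s" "k div s"] by simp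
  have zero: "d = 0" if "[\<gamma> * N ^ d = \<gamma>] (mod n)" "d < s" for d
    using that not_less_Least[of d "\<lambda>s. 0 < s \<and> [\<gamma> * N ^ s = \<gamma>] (mod n)"]
    unfolding s_def coset_period_def by auto
  have le: "a = b" if "a \<le> b" "b < s" "[\<gamma> * N ^ a = \<gamma> * N ^ b] (mod n)" for a b
  proof -
    have "[\<gamma> * N ^ a = (\<gamma> * N ^ (b - a)) * N ^ a] (mod n)"
      using that by (simp add: mult.assoc flip: power_add)
    hence "[\<gamma> = \<gamma> * N ^ (b - a)] (mod n)" by (rule cong_cancel_power[OF assms(2)])
    hence "b - a = 0" using that by (intro zero) (auto simp: cong_sym_eq)
    thus ?thesis using that by simp
  qed
  show "[\<gamma> * N ^ i = \<gamma> * N ^ j] (mod n) \<longleftrightarrow> [i = j] (mod s)"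
  proof
    assume "[\<gamma> * N ^ i = \<gamma> * N ^ j] (mod n)"
    hence "[\<gamma> * N ^ (i mod s) = \<gamma> * N ^ (j mod s)] (mod n)"
      using red cong_trans cong_sym by blast
    thus "[i = j] (mod s)"
      using le[of "i mod s" "j mod s"] le[of "j mod s" "i mod s"] \<open>0 < s\<close>
      unfolding cong_def by (metis mod_less_divisor nat_le_linear)
  next
    assume "[i = j] (mod s)"
    thus "[\<gamma> * N ^ i = \<gamma> * N ^ j] (mod n)"
      using red[of i] red[of j] by (metis cong_def)
  qed
qed

lemma cyc_coset_eq_range:
  assumes "0 < n" "coprime n N"
  shows "cyc_coset n N \<gamma> = range (\<lambda>k. \<gamma> * N ^ k mod n)"
proof (intro equalityI subsetI)
  fix x assume "x \<in> range (\<lambda>k. \<gamma> * N ^ k mod n)"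
  then obtain k where k: "x = \<gamma> * N ^ k mod n" by auto
  let ?s = "coset_period n N \<gamma>"
  have "x = \<gamma> * N ^ (k mod ?s) mod n"
    using power_cong_iff(2)[OF assms, of \<gamma> k "k mod ?s"] k by (simp add: cong_def)
  thus "x \<in> cyc_coset n N \<gamma>"
    using power_cong_iff(1)[OF assms, of \<gamma>] unfolding cyc_coset_def by auto
qed (auto simp: cyc_coset_def)

lemma tau_eq_period:
  assumes "0 < n" "coprime n q"
  shows "tau n q \<gamma> = coset_period n q \<gamma>"
proof -
  have "inj_on (\<lambda>k. \<gamma> * q ^ k mod n) {..<coset_period n q \<gamma>}"
    using power_cong_iff(2)[OF assms, of \<gamma>] by (auto simp: inj_on_def cong_def)
  thus ?thesis unfolding tau_def cyc_coset_def by (simp add: card_image)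
qed

lemma cyc_coset_eqI:
  assumes "0 < n" "coprime n N" "x \<in> cyc_coset n N \<gamma>"
  shows "cyc_coset n N x = cyc_coset n N \<gamma>"
proof -
  obtain i where x: "x = \<gamma> * N ^ i mod n"
    using assms(3) unfolding cyc_coset_eq_range[OF assms(1,2)] by auto
  have *: "x * N ^ k mod n = \<gamma> * N ^ (i + k) mod n" for k
    unfolding x by (simp add: mod_mult_left_eq power_add mult.assoc)
  let ?s = "coset_period n N \<gamma>"
  have s: "0 < ?s" by (rule power_cong_iff(1)[OF assms(1,2)])
  have "\<gamma> * N ^ k mod n = x * N ^ (k + i * (?s - 1)) mod n" for k
  proof -
    have "i + (k + i * (?s - 1)) = k + i * ?s" using s by (cases ?s) auto
    hence "[k = i + (k + i * (?s - 1))] (mod ?s)" unfolding cong_def by (metis mod_mult_self1)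
    thus ?thesis using power_cong_iff(2)[OF assms(1,2), of \<gamma>] unfolding * cong_def by blast
  qed
  thus ?thesis unfolding cyc_coset_eq_range[OF assms(1,2)] using * by (auto simp: image_iff)
qed

lemma cyc_decomp_disjoint:
  assumes "0 < n" "coprime n q"
  shows "disjoint_family_on (\<lambda>j. cyc_coset n (q ^ t) (\<gamma> * q ^ j mod n))
           {..<gcd t (tau n q \<gamma>)}"
  unfolding disjoint_family_on_def
proof safe
  fix i j x assume ij: "i < gcd t (tau n q \<gamma>)" "j < gcd t (tau n q \<gamma>)" "i \<noteq> j"
    and x: "x \<in> cyc_coset n (q ^ t) (\<gamma> * q ^ i mod n)" "x \<in> cyc_coset n (q ^ t) (\<gamma> * q ^ j mod n)"
  have cp: "coprime n (q ^ t)" using assms by simp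
  obtain a where a: "x = (\<gamma> * q ^ i mod n) * (q ^ t) ^ a mod n"
    using x(1) unfolding cyc_coset_eq_range[OF assms(1) cp] by auto
  obtain b where b: "x = (\<gamma> * q ^ j mod n) * (q ^ t) ^ b mod n"
    using x(2) unfolding cyc_coset_eq_range[OF assms(1) cp] by auto
  have "[\<gamma> * q ^ (i + t * a) = \<gamma> * q ^ (j + t * b)] (mod n)"
    using a b unfolding cong_def
    by (simp add: mod_mult_left_eq power_add mult.assoc power_mult)
  hence "[i + t * a = j + t * b] (mod tau n q \<gamma>)"
    using power_cong_iff(2)[OF assms] tau_eq_period[OF assms] by metis
  hence "[i + t * a = j + t * b] (mod gcd t (tau n q \<gamma>))"
    by (rule cong_dvd_modulus_nat) simp
  moreover have "[i + t * a = i + 0] (mod gcd t (tau n q \<gamma>))"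
    "[j + t * b = j + 0] (mod gcd t (tau n q \<gamma>))"
    by (intro cong_add; simp add: cong_0_iff)+
  ultimately have "[i = j] (mod gcd t (tau n q \<gamma>))"
    by (metis add_0_right cong_def)
  thus "x \<in> {}" using ij cong_less_modulus_unique_nat by blast
qed

lemma cyc_decomp_eq:
  assumes "0 < n" "coprime n q"
  shows "cyc_decomp n q t \<gamma> = cyc_coset n (q ^ t) ` cyc_coset n q \<gamma>"
proof (intro equalityI subsetI)
  have cp: "coprime n (q ^ t)" using assms by simp
  have tau: "0 < tau n q \<gamma>" using power_cong_iff(1)[OF assms] tau_eq_period[OF assms] by metis
  fix X assume "X \<in> cyc_coset n (q ^ t) ` cyc_coset n q \<gamma>"
  then obtain k where X: "X = cyc_coset n (q ^ t) (\<gamma> * q ^ k mod n)"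
    unfolding cyc_coset_eq_range[OF assms] by auto
  define g where "g = gcd t (tau n q \<gamma>)"
  have g: "0 < g" using tau unfolding g_def by simp
  obtain a where a: "[t * a = g] (mod tau n q \<gamma>)"
    unfolding g_def using cong_solve_nat[of t "tau n q \<gamma>"] by (cases "t = 0") (auto simp: cong_def)
  have "[k mod g + t * (a * (k div g)) = k mod g + g * (k div g)] (mod tau n q \<gamma>)"
    using cong_scalar_right[OF a, of "k div g"] by (intro cong_add) (auto simp: mult.assoc)
  hence "[k mod g + t * (a * (k div g)) = k] (mod tau n q \<gamma>)" by simp
  hence "\<gamma> * q ^ k mod n = \<gamma> * q ^ (k mod g + t * (a * (k div g))) mod n"
    using power_cong_iff(2)[OF assms] tau_eq_period[OF assms] unfolding cong_def by metis
  also have "\<dots> = (\<gamma> * q ^ (k mod g) mod n) * (q ^ t) ^ (a * (k div g)) mod n"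
    by (simp add: mod_mult_left_eq power_add mult.assoc power_mult)
  finally have "\<gamma> * q ^ k mod n \<in> cyc_coset n (q ^ t) (\<gamma> * q ^ (k mod g) mod n)"
    unfolding cyc_coset_eq_range[OF assms(1) cp] by auto
  hence "X = cyc_coset n (q ^ t) (\<gamma> * q ^ (k mod g) mod n)"
    unfolding X by (rule cyc_coset_eqI[OF assms(1) cp])
  thus "X \<in> cyc_decomp n q t \<gamma>" using g unfolding cyc_decomp_def g_def by auto
qed (auto simp: cyc_decomp_def cyc_coset_eq_range[OF assms])

lemma cyc_decomp_Union:
  assumes "0 < n" "coprime n q"
  shows "\<Union>(cyc_decomp n q t \<gamma>) = cyc_coset n q \<gamma>"
proof -
  have cp: "coprime n (q ^ t)" using assms by simp
  have "cyc_coset n (q ^ t) x \<subseteq> cyc_coset n q x" for x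
    unfolding cyc_coset_eq_range[OF assms(1) cp] cyc_coset_eq_range[OF assms(1,2)]
    by (auto simp flip: power_mult)
  moreover have "x \<in> cyc_coset n (q ^ t) x" if "x \<in> cyc_coset n q \<gamma>" for x
  proof -
    have "x = x * (q ^ t) ^ 0 mod n" using that by (auto simp: cyc_coset_def)
    thus ?thesis unfolding cyc_coset_eq_range[OF assms(1) cp] by blast
  qed
  ultimately show ?thesis
    unfolding cyc_decomp_eq[OF assms(1,2)] using cyc_coset_eqI[OF assms(1,2)] by blast
qed

lemma cyc_decomp_tuple_coset:
  assumes "0 < n" "coprime n q" "\<gamma> < n"
  shows "cyc_decomp_tuple n q t (cyc_coset n q \<gamma>) = cyc_decomp n q t \<gamma>"
proof -
  have "\<gamma> * q ^ 0 mod n \<in> cyc_coset n q \<gamma>" unfolding cyc_coset_eq_range[OF assms(1,2)] by blast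
  hence "(SOME x. x \<in> cyc_coset n q \<gamma>) \<in> cyc_coset n q \<gamma>" by (rule someI)
  from cyc_coset_eqI[OF assms(1,2) this] show ?thesis
    unfolding cyc_decomp_tuple_def cyc_cosets_def cyc_decomp_eq[OF assms(1,2)] using assms(3) by simp
qed

end

theory Submission
  imports Defs
begin

text \<open>
  Put \<open>Q = q\<^sup>t\<close> and \<open>m = n / gcd(\<gamma>, n)\<close>. All elements of a coset have the same gcd \<open>d\<close> with \<open>n\<close>. If a
  \<open>Q\<close>-coset of size \<open>s\<close> is the whole progression \<open>e + (n/s)\<int>\<close>, then \<open>n/s = d D'\<close> with
  \<open>D' dvd Q - 1\<close>, and each prime \<open>p\<close> dividing \<open>m\<close> divides \<open>D'\<close>, since otherwise some element of the
  progression would be divisible by \<open>d p\<close>. So \<open>rad m dvd Q - 1\<close>. If moreover \<open>8 dvd m\<close> and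
  \<open>Q\<close> is 3 modulo 4, then \<open>D'\<close> is 2 modulo 4 and, modulo 8, the progression meets every odd class,
  whereas the coset meets only two. Conversely, the coset lies in a progression of size
  \<open>m / gcd(m, Q - 1)\<close>, and lifting the exponent shows that its size is a multiple of this number.
  Both conditions on \<open>Q = q\<^sup>t\<close> together say that \<open>\<omega>\<close> divides \<open>t\<close>. Finally, the decomposition for
  \<open>t\<close> depends only on \<open>gcd(t, \<tau>)\<close>, and refinement corresponds to divisibility of these gcds.
\<close>

section \<open>Lifting the exponent\<close>

lemma prime_square_not_dvd_geometric_sum:
  fixes p :: nat and R :: int
  assumes p: "prime p" and R: "[R = 1] (mod int p)" and p2: "p = 2 \<Longrightarrow> [R = 1] (mod 4)"
  shows "\<not> int (p ^ 2) dvd (\<Sum>i<p. R ^ i)"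
proof -
  from R obtain c where c: "R = 1 + int p * c"
    by (metis cong_iff_lin cong_sym mult.commute)
  \<comment> \<open>First-order binomial expansion of \<open>(1 + p c) ^ i\<close>. Summing over
    \<open>i < p\<close> leaves \<open>p\<close> plus \<open>p c\<close> times the sum of the
    indices. For odd \<open>p\<close> that sum is a multiple of \<open>p\<close>. For
    \<open>p = 2\<close> it is 1, and the hypothesis modulo 4 makes \<open>c\<close> even
    instead.\<close>
  have pw: "[R ^ i = 1 + int i * (int p * c)] (mod int (p ^ 2))" for i
  proof (induction i)
    case (Suc i)
    have "[R ^ i * R = (1 + int i * (int p * c)) * R] (mod int (p ^ 2))"
      using Suc by (intro cong_mult cong_refl)
    also have "(1 + int i * (int p * c)) * R = (1 + int (Suc i) * (int p * c)) + int (p ^ 2) * (int i * c * c)"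
      by (simp add: c algebra_simps power2_eq_square)
    also have "[\<dots> = 1 + int (Suc i) * (int p * c)] (mod int (p ^ 2))"
      by (simp add: cong_def)
    finally show ?case by (simp add: mult.commute)
  qed auto
  have "[(\<Sum>i<p. R ^ i) = (\<Sum>i<p. 1 + int i * (int p * c))] (mod int (p ^ 2))"
    by (intro cong_sum pw)
  also have "(\<Sum>i<p. 1 + int i * (int p * c)) = int p + (\<Sum>i<p. int i) * (int p * c)"
    by (simp add: sum.distrib sum_distrib_right)
  also have "[\<dots> = int p + 0] (mod int (p ^ 2))"
  proof (intro cong_add cong_refl, unfold cong_0_iff)
    show "int (p ^ 2) dvd (\<Sum>i<p. int i) * (int p * c)"
    proof (cases "p = 2")
      case True
      from p2[OF this] c True have "[1 + 2 * c = 1] (mod 4)" by simp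
      hence "even c" by (auto simp: cong_def) presburger
      thus ?thesis using True by (auto simp: numeral_2_eq_2)
    next
      case False
      have "odd p" using p False primes_dvd_imp_eq two_is_prime_nat by blast
      then obtain h where h: "p = 2 * h + 1" by (elim oddE)
      have "(\<Sum>i<2 * h + 1. int i) = int (2 * h + 1) * int h" for h
        by (induction h) (auto simp: algebra_simps)
      hence "(\<Sum>i<p. int i) = int p * int h" using h by metis
      thus ?thesis by (simp add: power2_eq_square)
    qed
  qed
  finally have "[(\<Sum>i<p. R ^ i) = int p] (mod int (p ^ 2))" by simp
  moreover have "\<not> int (p ^ 2) dvd int p"
    using prime_gt_1_nat[OF p] by (simp add: power2_eq_square del: of_nat_power of_nat_mult)
  ultimately show ?thesis using cong_dvd_iff by blast
qed

text \<open>The upper bound of lifting the exponent, phrased with prime powers so that zero needs no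
  valuation. If \<open>p\<close> does not divide \<open>k\<close>, the geometric sum is congruent to
  \<open>k\<close> modulo \<open>p\<close> and contributes nothing. If \<open>k = l * p\<close>,
  passing from \<open>Q ^ l\<close> to \<open>Q ^ k\<close> gains at most one factor
  \<open>p\<close>, by the preceding lemma, and the induction continues with
  \<open>l\<close>.\<close>

lemma prime_power_dvd_exponent:
  fixes p a k :: nat and Q :: int
  assumes p: "prime p" and Q: "[Q = 1] (mod int p)" and p2: "p = 2 \<Longrightarrow> [Q = 1] (mod 4)"
    and "int p ^ a dvd Q ^ k - 1"
  shows "int p ^ a dvd (Q - 1) * int k"
  using assms(4)
proof (induction k arbitrary: a rule: less_induct)
  case (less k)
  have pp: "prime (int p)" using p by simp
  show ?case
  proof (cases "k = 0 \<or> a = 0")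
    case False
    hence k: "0 < k" and a: "0 < a" by auto
    show ?thesis
    proof (cases "p dvd k")
      case False
      have "[(\<Sum>i<k. Q ^ i) = (\<Sum>i<k. 1 ^ i)] (mod int p)"
        by (intro cong_sum cong_pow Q)
      hence "[(\<Sum>i<k. Q ^ i) = int k] (mod int p)" by simp
      hence "\<not> int p dvd (\<Sum>i<k. Q ^ i)" using False cong_dvd_iff by fastforce
      hence "coprime (int p ^ a) (\<Sum>i<k. Q ^ i)"
        using prime_imp_coprime[OF pp] by auto
      moreover have "Q ^ k - 1 = (Q - 1) * (\<Sum>i<k. Q ^ i)" by (rule power_diff_1_eq)
      ultimately have "int p ^ a dvd Q - 1"
        using less.prems by (metis coprime_dvd_mult_left_iff)
      thus ?thesis by simp
    next
      case True
      then obtain l where l: "k = l * p" by (metis dvd_def mult.commute)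
      define R where "R = Q ^ l"
      have R: "[R = 1] (mod int p)" using cong_pow[OF Q, of l] by (simp add: R_def)
      have R2: "[R = 1] (mod 4)" if "p = 2" using cong_pow[OF p2[OF that], of l] by (simp add: R_def)
      define S where "S = (\<Sum>i<p. R ^ i)"
      have ns: "\<not> int p * int p dvd S"
        using prime_square_not_dvd_geometric_sum[OF p R R2] by (simp add: S_def power2_eq_square)
      have eq: "Q ^ k - 1 = S * (R - 1)"
        by (simp add: l R_def S_def power_mult power_diff_1_eq mult.commute)
      have "int p ^ (a - 1) dvd R - 1"
      proof (cases "int p dvd S")
        case True
        then obtain S' where S': "S = int p * S'" by blast
        hence "\<not> int p dvd S'" using ns by auto
        hence cop: "coprime (int p ^ (a - 1)) S'" using prime_imp_coprime[OF pp] by auto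
        have "int p * int p ^ (a - 1) dvd int p * (S' * (R - 1))"
          using less.prems a unfolding eq S' by (cases a) (auto simp: mult_ac)
        hence "int p ^ (a - 1) dvd S' * (R - 1)" using prime_gt_0_nat[OF p] by simp
        thus ?thesis using cop by (simp add: coprime_dvd_mult_right_iff)
      next
        case False
        hence "coprime (int p ^ a) S" using prime_imp_coprime[OF pp] by auto
        hence "int p ^ a dvd R - 1" using less.prems unfolding eq by (simp add: coprime_dvd_mult_right_iff)
        thus ?thesis by (meson diff_le_self dvd_trans le_imp_power_dvd)
      qed
      moreover have "l < k" using k l prime_gt_1_nat[OF p] by simp
      ultimately have "int p ^ (a - 1) dvd (Q - 1) * int l"
        using less.IH unfolding R_def by blast
      hence "int p ^ (a - 1) * int p dvd (Q - 1) * int l * int p" by (intro mult_dvd_mono) auto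
      thus ?thesis using a by (cases a) (auto simp: l mult_ac)
    qed
  qed auto
qed

section \<open>The arithmetic condition on \<open>Q\<close> and its translation into
  \<open>omega\<close>\<close>

lemma cong_1_iff_dvd: "0 < a \<Longrightarrow> [a = 1] (mod m) \<longleftrightarrow> m dvd a - 1" for a m :: nat
  by (intro cong_altdef_nat) simp

lemma odd_cong_4: "odd a \<Longrightarrow> [a = 1] (mod 4) \<or> [a = 3] (mod 4)" for a :: nat
  by (simp add: cong_def) presburger

text \<open>The interface between the two halves of the proof: it characterises both the
  equal-difference property of \<open>Q\<close>-cosets and, for \<open>Q = q ^ t\<close>,
  divisibility of \<open>t\<close> by \<open>omega\<close>.\<close>

definition liftable :: "nat \<Rightarrow> nat \<Rightarrow> bool" where
  "liftable m Q \<longleftrightarrow> (\<forall>p. prime p \<longrightarrow> p dvd m \<longrightarrow> [Q = 1] (mod p)) \<and> \<not> (8 dvd m \<and> [Q = 3] (mod 4))"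

text \<open>Checked on each prime power dividing \<open>m\<close>. Lifting the exponent applies
  except for \<open>p = 2\<close> with \<open>Q\<close> congruent to 3 modulo 4. There 8 does not
  divide \<open>m\<close>, so only 2 and 4 can occur: \<open>Q - 1\<close> is even, and
  \<open>4 dvd Q ^ k - 1\<close> forces \<open>k\<close> to be even as well.\<close>

lemma liftable_dvd_exponent:
  assumes lift: "liftable m Q" and "0 < Q" "0 < m" and dvd: "m dvd Q ^ k - 1"
  shows "m dvd (Q - 1) * k"
\<comment> \<open>The multiplicity of a prime in 0 is 0 by convention, so the comparison of
  multiplicities below works only for a nonzero product.\<close>
proof (cases "(Q - 1) * k = 0")
  case False
  have Q1: "int (Q - 1) = int Q - 1" "int (Q ^ k - 1) = int Q ^ k - 1"
    using \<open>0 < Q\<close> by (auto simp: of_nat_diff)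
  have pp: "p ^ a dvd (Q - 1) * k" if p: "prime p" and a: "p ^ a dvd m" "0 < a" for p a
  proof -
    have pm: "p dvd m" using a by (meson dvd_power dvd_trans)
    have Q: "[int Q = 1] (mod int p)"
      using lift p pm unfolding liftable_def by (metis cong_int_iff of_nat_1)
    have d: "p ^ a dvd Q ^ k - 1" using a dvd by (rule_tac dvd_trans)
    show ?thesis
    proof (cases "p = 2 \<and> \<not> [Q = 1] (mod 4)")
      case False
      have "p = 2 \<Longrightarrow> [int Q = 1] (mod 4)"
        using False by (metis cong_int_iff of_nat_1 of_nat_numeral)
      moreover have "int p ^ a dvd int Q ^ k - 1"
        using d Q1 by (metis int_dvd_int_iff of_nat_power)
      ultimately have "int p ^ a dvd (int Q - 1) * int k"
        using prime_power_dvd_exponent[OF p Q] by blast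
      thus ?thesis using Q1 by (metis int_dvd_int_iff of_nat_mult of_nat_power)
    next
      case True
      have odd: "odd Q" using Q True by (auto simp: cong_iff_dvd_diff)
      hence Q3: "[Q = 3] (mod 4)" using True odd_cong_4 by blast
      hence "\<not> 8 dvd m" using lift by (auto simp: liftable_def)
      have "a < 3"
      proof (rule ccontr)
        assume "\<not> a < 3"
        hence "p ^ 3 dvd p ^ a" by (intro le_imp_power_dvd) simp
        thus False using a True \<open>\<not> 8 dvd m\<close> by (auto dest: dvd_trans)
      qed
      with a have "a = 1 \<or> a = 2" by auto
      thus ?thesis
      proof
        assume "a = 1" thus ?thesis using True odd by simp
      next
        assume a2: "a = 2"
        have "even k"
        proof (rule ccontr)
          assume "odd k"
          then obtain h where h: "k = 2 * h + 1" by (elim oddE)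
          have "[(Q ^ 2) ^ h * Q = (3 ^ 2) ^ h * 3] (mod 4)" by (intro cong_mult cong_pow Q3)
          also have "[(3 ^ 2) ^ h * 3 = 1 ^ h * (3::nat)] (mod 4)"
            by (intro cong_mult cong_pow) (auto simp: cong_def)
          finally have "[Q ^ k = 3] (mod 4)" by (simp only: h power_add power_mult power_one_right power_one mult_1)
          moreover have "[Q ^ k = 1] (mod 4)"
            using d True a2 \<open>0 < Q\<close> cong_1_iff_dvd[of "Q ^ k" 4] by simp
          ultimately show False by (simp add: cong_def)
        qed
        thus ?thesis using True odd a2 by (auto simp: elim!: evenE intro: mult_dvd_mono)
      qed
    qed
  qed
  show ?thesis
  proof (rule multiplicity_le_imp_dvd)
    fix p :: nat assume p: "prime p"
    show "multiplicity p m \<le> multiplicity p ((Q - 1) * k)"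
    proof (cases "multiplicity p m = 0")
      case nz: False
      have "p ^ multiplicity p m dvd (Q - 1) * k"
        using pp[OF p, of "multiplicity p m"] nz by (simp add: multiplicity_dvd)
      thus ?thesis using p False by (intro multiplicity_geI) (auto simp del: mult_eq_0_iff)
    qed auto
  qed (use \<open>0 < m\<close> in auto)
qed (metis dvd_0_right)

text \<open>By the Chinese remainder theorem the order modulo \<open>rad m\<close> divides
  \<open>t\<close> iff \<open>q ^ t\<close> is 1 modulo each prime dividing \<open>m\<close>. If in
  addition \<open>8 dvd m\<close> and \<open>q ^ o'\<close> is 3 modulo 4, then for
  \<open>t = o' * k\<close> the power \<open>q ^ t\<close> is 3 modulo 4 exactly when
  \<open>k\<close> is odd; the extra factor 2 in \<open>omega\<close> excludes this.\<close>

lemma omega_dvd_iff: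
  assumes "0 < m" "coprime m q"
  shows "omega m q dvd t \<longleftrightarrow> liftable m (q ^ t)"
proof -
  define o' where "o' = ord (rad m) q"
  have "[q ^ t = 1] (mod rad m) \<longleftrightarrow> (\<forall>p\<in>prime_factors m. [q ^ t = 1] (mod p))"
  proof
    assume "[q ^ t = 1] (mod rad m)"
    moreover have "p dvd rad m" if "p \<in> prime_factors m" for p
      unfolding rad_def using that by (intro dvd_prodI) auto
    ultimately show "\<forall>p\<in>prime_factors m. [q ^ t = 1] (mod p)"
      using cong_dvd_modulus_nat by blast
  next
    assume "\<forall>p\<in>prime_factors m. [q ^ t = 1] (mod p)"
    thus "[q ^ t = 1] (mod rad m)" unfolding rad_def
      by (intro coprime_cong_prod_nat) (auto intro: primes_coprime)
  qed
  hence div: "o' dvd t \<longleftrightarrow> (\<forall>p. prime p \<longrightarrow> p dvd m \<longrightarrow> [q ^ t = 1] (mod p))"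
    using assms(1) by (auto simp: o'_def ord_divides[symmetric] in_prime_factors_iff)
  show ?thesis
  \<comment> \<open>If \<open>o'\<close> does not divide \<open>t\<close>, both sides fail; if 8
    does not divide \<open>m\<close>, both reduce to \<open>o' dvd t\<close>.\<close>
  proof (cases "8 dvd m \<and> o' dvd t")
    case False
    moreover have "o' dvd omega m q" by (simp add: omega_def o'_def)
    moreover have "omega m q = o'" if "\<not> 8 dvd m" using that by (simp add: omega_def o'_def)
    ultimately show ?thesis using div unfolding liftable_def by (metis dvd_trans)
  next
    case True
    then obtain k where k: "t = o' * k" by blast
    have "even m" using True by (meson dvd_trans even_numeral)
    hence "odd q" using coprime_common_divisor[OF assms(2), of 2] by auto
    have q4: "[q ^ o' = 1] (mod 4) \<or> [q ^ o' = 3] (mod 4)"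
      using odd_cong_4[of "q ^ o'"] \<open>odd q\<close> by simp
    show ?thesis
    proof (cases "[q ^ o' = 3] (mod 4)")
      case False
      with q4 have "[(q ^ o') ^ k = 1 ^ k] (mod 4)" by (intro cong_pow) auto
      hence "[q ^ t = 1] (mod 4)" by (simp add: k power_mult)
      hence "\<not> [q ^ t = 3] (mod 4)" by (simp add: cong_def)
      moreover have "omega m q = o'" using False by (simp add: omega_def o'_def)
      ultimately show ?thesis using True div unfolding liftable_def by auto
    next
      case q3: True
      have om: "omega m q = 2 * o'" using q3 True by (simp add: omega_def o'_def)
      have sq: "[(q ^ o') ^ (2 * h) = 1] (mod 4)" for h
      proof -
        have "[((q ^ o') ^ 2) ^ h = ((3::nat) ^ 2) ^ h] (mod 4)" by (intro cong_pow q3)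
        also have "[((3::nat) ^ 2) ^ h = 1 ^ h] (mod 4)" by (intro cong_pow) (simp add: cong_def)
        finally show ?thesis by (simp add: power_mult)
      qed
      have "[q ^ t = 3] (mod 4) \<longleftrightarrow> odd k"
      proof
        assume "[q ^ t = 3] (mod 4)"
        thus "odd k" using sq by (auto simp: k power_mult cong_def elim!: evenE)
      next
        assume "odd k"
        then obtain h where h: "k = 2 * h + 1" by (elim oddE)
        have "[(q ^ o') ^ (2 * h) * q ^ o' = 1 * 3] (mod 4)" by (intro cong_mult sq q3)
        thus "[q ^ t = 3] (mod 4)"
          by (simp only: k h power_mult power_add power_one_right mult_1)
      qed
      moreover have "2 * o' dvd t \<longleftrightarrow> even k \<or> o' = 0"
        unfolding k mult.commute[of 2 o'] by (simp only: nat_mult_dvd_cancel_disj) blast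
      \<comment> \<open>\<open>ord\<close> is 0 exactly on arguments that are not coprime; excluding
        this leaves \<open>even k\<close> in the equivalence above.\<close>
      moreover have "coprime (rad m) q" unfolding rad_def
        by (intro prod_coprime_left)
           (auto intro: coprime_divisors[OF _ dvd_refl assms(2)])
      hence "o' \<noteq> 0" by (simp add: o'_def ord_eq_0)
      ultimately show ?thesis using True div unfolding om liftable_def by blast
    qed
  qed
qed

section \<open>Equal-difference cosets\<close>

lemma gcd_cyc_coset:
  assumes "0 < n" "coprime n N" "y \<in> cyc_coset n N x"
  shows "gcd y n = gcd x n"
proof -
  obtain k where "y = x * N ^ k mod n" using assms unfolding cyc_coset_eq_range[OF assms(1,2)] by blast
  hence "gcd y n = gcd (x * N ^ k) n" using assms(1) by (simp add: gcd_mod_left)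
  also have "\<dots> = gcd x n" using assms(2)
    by (intro gcd_mult_right_right_cancel[THEN trans[OF gcd.commute], THEN trans[OF _ gcd.commute]]) auto
  finally show ?thesis .
qed

text \<open>Dividing \<open>x\<close> and \<open>n\<close> by their gcd leaves a factor that is
  invertible modulo the new modulus. This turns the period of a coset into a multiplicative
  order.\<close>

lemma cong_mult_self_iff:
  fixes n x a :: nat
  assumes "0 < n"
  shows "[x * a = x] (mod n) \<longleftrightarrow> [a = 1] (mod (n div gcd x n))"
proof -
  define d where "d = gcd x n"
  have "0 < d" using assms by (simp add: d_def)
  obtain u m where um: "x = d * u" "n = d * m" "coprime u m"
    unfolding d_def using gcd_coprime_exists[of x n] assms by (auto simp: mult.commute)
  have "[x * a = x] (mod n) \<longleftrightarrow> [d * (u * a) = d * (u * 1)] (mod (d * m))"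
    using um by (simp add: mult.assoc)
  also have "\<dots> \<longleftrightarrow> [u * a = u * 1] (mod m)"
    using \<open>0 < d\<close> by (simp add: cong_def flip: mult_mod_right)
  also have "\<dots> \<longleftrightarrow> [a = 1] (mod m)" using um(3) by (intro cong_mult_lcancel_nat)
  also have "m = n div gcd x n" using \<open>0 < d\<close> um(2) d_def by (metis nonzero_mult_div_cancel_left not_gr0)
  finally show ?thesis .
qed

text \<open>After \<open>s\<close> steps of length \<open>D\<close> the progression closes up modulo
  \<open>n\<close>, so indices may be unbounded and witnesses need no range check.\<close>

lemma progression_eq_range:
  fixes n s e D :: nat
  assumes "n = s * D" "0 < n"
  shows "(\<lambda>i. (e + i * D) mod n) ` {..<s} = range (\<lambda>i. (e + i * D) mod n)"
proof (intro equalityI subsetI)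
  fix y assume "y \<in> range (\<lambda>i. (e + i * D) mod n)"
  then obtain i where y: "y = (e + i * D) mod n" by blast
  have "e + i * D = e + (i mod s) * D + n * (i div s)"
    by (simp add: assms(1) algebra_simps flip: distrib_right)
       (metis add_mult_distrib2 mod_mult_div_eq mult.assoc mult.commute)
  hence "y = (e + (i mod s) * D) mod n" using y by (metis mod_mult_self2)
  moreover have "i mod s < s" using assms by simp
  ultimately show "y \<in> (\<lambda>i. (e + i * D) mod n) ` {..<s}" by blast
qed auto

text \<open>After division by the common gcd \<open>d\<close>, the terms \<open>u + i * D'\<close>
  and the powers \<open>u * Q ^ k\<close> run through the same classes modulo \<open>m\<close>, all
  coprime to \<open>m\<close>. That powers are terms gives \<open>Q\<close> congruent to 1 modulo
  \<open>D'\<close>; coprimality forces every prime of \<open>m\<close> into \<open>D'\<close>; that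
  terms are powers yields the obstruction modulo 8.\<close>

lemma equal_diff_cyc_coset_imp_liftable:
  assumes n: "0 < n" and Q: "coprime n Q" "0 < Q"
    and ed: "equal_diff_subset n C (cyc_coset n Q x)"
  shows "liftable (n div gcd x n) Q"
proof -
  define E s D where "E = cyc_coset n Q x" and "s = card E" and "D = n div s"
  have nD: "n = s * D" using ed by (simp add: equal_diff_subset_def E_def s_def D_def)
  from ed obtain e where e: "e \<in> E" and Ee: "E = (\<lambda>i. (e + i * D) mod n) ` {..<s}"
    unfolding equal_diff_subset_def E_def s_def D_def by blast
  have Er: "E = range (\<lambda>i. (e + i * D) mod n)"
    using progression_eq_range[OF nD n] Ee by simp
  have Eo: "E = range (\<lambda>k. e * Q ^ k mod n)"
    using cyc_coset_eqI[OF n Q(1)] e unfolding E_def cyc_coset_eq_range[OF n Q(1), symmetric] by blast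
  define d m where "d = gcd x n" and "m = n div gcd x n"
  have d0: "0 < d" using n by (simp add: d_def)
  have gcdE: "gcd y n = d" if "y \<in> E" for y
    using gcd_cyc_coset[OF n Q(1)] that by (simp add: E_def d_def)
  have gcdi: "gcd (e + i * D) n = d" for i
  proof -
    have "(e + i * D) mod n \<in> E" unfolding Er by blast
    from gcdE[OF this] show ?thesis using n by (simp add: gcd_mod_left)
  qed
  have nm: "n = d * m" by (simp add: d_def m_def)
  have "d dvd e" "d dvd e + D" using gcdi[of 0] gcdi[of 1] by (metis gcd_dvd1 add_0_right mult_0, metis gcd_dvd1 mult_1)
  then obtain u D' where u: "e = d * u" and D': "D = d * D'"
    by (metis dvd_add_right_iff dvd_def)
  have mD: "m = s * D'"
  proof -
    have "d * m = d * (s * D')" using nD unfolding nm D' by (simp only: mult.left_commute)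
    thus ?thesis using d0 by simp
  qed
  have m0: "0 < m" using n nm by simp
  have cop: "coprime (u + i * D') m" for i
  proof -
    have "d * (u + i * D') = e + i * D" by (simp add: u D' algebra_simps)
    hence "d * gcd (u + i * D') m = d" using gcdi[of i]
      by (simp only: gcd_mult_distrib_nat nm[symmetric])
    hence "gcd (u + i * D') m = 1" using d0 by simp
    thus ?thesis by (simp only: coprime_iff_gcd_eq_1)
  qed
  have copu: "coprime u m" using cop[of 0] by simp
  have powE: "\<exists>i. [u * Q ^ k = u + i * D'] (mod m)" for k
  proof -
    have "e * Q ^ k mod n \<in> E" unfolding Eo by blast
    then obtain i where "[e * Q ^ k = e + i * D] (mod n)" unfolding Er cong_def by auto
    hence "[d * (u * Q ^ k) = d * (u + i * D')] (mod (d * m))"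
      by (simp add: u D' nm[symmetric] distrib_left mult_ac)
    hence "[u * Q ^ k = u + i * D'] (mod m)" using d0 by (simp add: cong_def flip: mult_mod_right)
    thus ?thesis by blast
  qed
  have Epow: "\<exists>k. [u * Q ^ k = u + i * D'] (mod m)" for i
  proof -
    have "(e + i * D) mod n \<in> E" unfolding Er by blast
    then obtain k where "[e * Q ^ k = e + i * D] (mod n)" unfolding Eo cong_def by auto
    hence "[d * (u * Q ^ k) = d * (u + i * D')] (mod (d * m))"
      by (simp add: u D' nm[symmetric] distrib_left mult_ac)
    hence "[u * Q ^ k = u + i * D'] (mod m)" using d0 by (simp add: cong_def flip: mult_mod_right)
    thus ?thesis by blast
  qed
  have QD: "[Q = 1] (mod D')"
  proof -
    obtain i where "[u * Q ^ 1 = u + i * D'] (mod m)" using powE[of 1] by blast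
    hence "[u * Q = u + i * D'] (mod D')" using mD by (metis cong_dvd_modulus_nat dvd_triv_right power_one_right)
    hence "[u * Q = u * 1] (mod D')" by (simp add: cong_def)
    moreover have "coprime u D'" using copu mD by simp
    ultimately show ?thesis using cong_mult_lcancel_nat by blast
  qed
  have pD: "p dvd D'" if p: "prime p" "p dvd m" for p
  proof (rule ccontr)
    assume "\<not> p dvd D'"
    hence "coprime D' p" using p by (metis prime_imp_coprime coprime_commute)
    \<comment> \<open>With \<open>i\<close> inverse to \<open>D'\<close> and \<open>p - 1\<close>
      serving as -1, the index \<open>i * (u * (p - 1))\<close> produces a term divisible by
      \<open>p\<close>, against \<open>cop\<close>.\<close>
    then obtain i where "[D' * i = 1] (mod p)" using cong_solve_coprime_nat[of D' p] by auto
    hence "[u + D' * i * (u * (p - 1)) = u + 1 * (u * (p - 1))] (mod p)"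
      by (intro cong_add cong_mult cong_refl)
    also have "u + 1 * (u * (p - 1)) = u * p" using prime_gt_0_nat[OF p(1)] by (cases p) auto
    finally have "[u + D' * i * (u * (p - 1)) = u * p] (mod p)" .
    hence "p dvd u + D' * i * (u * (p - 1))" by (simp only: cong_dvd_iff dvd_triv_right)
    hence "p dvd u + (i * (u * (p - 1))) * D'" by (simp only: mult_ac)
    from coprime_common_divisor[OF cop this p(2)] show False using p(1) not_prime_unit by blast
  qed
  have "\<not> [Q = 3] (mod 4)" if m8: "8 dvd m"
  proof
    assume Q3: "[Q = 3] (mod 4)"
    have "even m" using m8 by (meson dvd_trans even_numeral)
    hence "even D'" using pD two_is_prime_nat by blast
    moreover have "\<not> 4 dvd D'"
    proof
      assume "4 dvd D'"
      hence "[Q = 1] (mod 4)" using QD cong_dvd_modulus_nat by blast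
      thus False using Q3 by (simp add: cong_def)
    qed
    ultimately obtain c where "D' = 2 * c" "odd c" by auto
    then obtain b where "D' = 2 * (2 * b + 1)" by (elim oddE) simp
    hence "2 * D' = 4 + 8 * b" by simp
    hence D8: "[2 * D' = 4] (mod 8)" by (simp only: cong_def mod_mult_self2)
    \<comment> \<open>The term of index 2 is \<open>u + 4\<close> modulo 8. Odd squares are 1 modulo
      8, so an even power of \<open>Q\<close> would give \<open>u\<close>, and an odd one
      \<open>u * Q\<close>, which is \<open>3 * u\<close> modulo 4. Neither fits, because
      \<open>u\<close> is odd.\<close>
    obtain k where "[u * Q ^ k = u + 2 * D'] (mod m)" using Epow by blast
    hence "[u * Q ^ k = u + 2 * D'] (mod 8)" using m8 cong_dvd_modulus_nat by blast
    also have "[u + 2 * D' = u + 4] (mod 8)" by (intro cong_add D8) auto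
    finally have k: "[u * Q ^ k = u + 4] (mod 8)" .
    have "odd u" using coprime_common_divisor[OF copu, of 2] \<open>even m\<close> by auto
    have "odd Q"
    proof
      assume "even Q"
      hence "[Q = 0] (mod 2)" by (simp add: cong_0_iff)
      moreover have "[Q = 3] (mod 2)" using cong_dvd_modulus_nat[OF Q3, of 2] by simp
      ultimately show False by (simp add: cong_def)
    qed
    hence "[Q ^ 2 = 1] (mod 8)" by (simp only: square_mod_8_eq_1_iff simp_thms)
    hence ev: "[Q ^ (2 * h) = 1] (mod 8)" for h
      using cong_pow[of "Q ^ 2" 1 8 h] by (simp add: power_mult)
    show False
    proof (cases "even k")
      case True
      then obtain h where "k = 2 * h" by blast
      hence "[u * Q ^ k = u * 1] (mod 8)" using ev by (intro cong_mult) auto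
      hence "[u + 4 = u] (mod 8)" using k by (simp add: cong_def)
      thus False by (simp add: cong_add_lcancel_0_nat cong_0_iff)
    next
      case False
      then obtain h where h: "k = 2 * h + 1" by (elim oddE)
      have "[u * (Q ^ (2 * h) * Q) = u * (1 * Q)] (mod 8)" using ev by (intro cong_mult) auto
      hence "[u * Q = u + 4] (mod 8)" using k by (simp add: h cong_def mult_ac)
      hence "[u * Q = u + 4] (mod 4)" by (rule cong_dvd_modulus_nat) simp
      moreover have "[u * Q = u * 3] (mod 4)" using Q3 by (intro cong_mult) auto
      ultimately have "[u * 3 = u + 4] (mod 4)" using cong_sym cong_trans by blast
      moreover have "u * 3 = u + 2 * u" by simp
      ultimately have "[2 * u = 4] (mod 4)" by (simp only: cong_add_lcancel_nat)
      hence "4 dvd 2 * u" by (simp add: cong_def dvd_eq_mod_eq_0)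
      thus False using \<open>odd u\<close> by presburger
    qed
  qed
  moreover have "[Q = 1] (mod p)" if "prime p" "p dvd m" for p
    using QD pD[OF that] cong_dvd_modulus_nat by blast
  ultimately show ?thesis unfolding liftable_def m_def by blast
qed

text \<open>All elements of the coset agree modulo \<open>D = d * g\<close> with
  \<open>g = gcd m (Q - 1)\<close>, so the coset lies in a progression of
  \<open>s' = m div g\<close> terms. Since \<open>m\<close> divides \<open>Q ^ s - 1\<close>,
  lifting gives \<open>s' dvd s\<close>, and counting forces equality.\<close>

lemma liftable_imp_equal_diff_cyc_coset:
  assumes n: "0 < n" and Q: "coprime n Q" "0 < Q"
    and lift: "liftable (n div gcd x n) Q" and sub: "cyc_coset n Q x \<subseteq> C"
  shows "equal_diff_subset n C (cyc_coset n Q x)"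
proof -
  define E s where "E = cyc_coset n Q x" and "s = card E"
  define d m where "d = gcd x n" and "m = n div gcd x n"
  have d0: "0 < d" using n by (simp add: d_def)
  have nm: "n = d * m" by (simp add: d_def m_def)
  have m0: "0 < m" using n nm by simp
  define g where "g = gcd m (Q - 1)"
  define s' where "s' = m div g"
  have g0: "0 < g" using m0 by (simp add: g_def)
  have mg: "m = s' * g" by (simp add: s'_def g_def)
  have s'0: "0 < s'" using m0 mg by simp
  define D where "D = d * g"
  have nD: "n = s' * D" by (simp add: D_def nm mg)
  have sper: "s = coset_period n Q x" using tau_eq_period[OF n Q(1)] by (simp add: s_def E_def tau_def)
  have s0: "0 < s" unfolding sper by (rule power_cong_iff(1)[OF n Q(1)])
  have "[x * Q ^ s = x * Q ^ 0] (mod n)" unfolding power_cong_iff(2)[OF n Q(1)] sper by (simp add: cong_def)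
  hence "[Q ^ s = 1] (mod m)" using cong_mult_self_iff[OF n] by (simp add: m_def)
  hence "m dvd Q ^ s - 1" using Q by (simp add: cong_1_iff_dvd del: One_nat_def)
  hence "m dvd (Q - 1) * s" using liftable_dvd_exponent lift Q m0 unfolding m_def by blast
  \<comment> \<open>Together with the trivial \<open>m dvd s * m\<close> this gives
    \<open>m dvd s * g\<close>, from which \<open>g\<close> cancels.\<close>
  hence "m dvd gcd (s * m) (s * (Q - 1))" by (simp add: mult.commute)
  hence "m dvd g * s" unfolding g_def gcd_mult_distrib_nat[symmetric] by (simp only: mult.commute)
  hence "s' dvd s" using g0 unfolding mg by (simp add: mult.commute)
  hence le: "s' \<le> s" using s0 by (simp add: dvd_imp_le)
  \<comment> \<open>The base point is the residue of \<open>x\<close>, as \<open>x\<close> itself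
    may exceed \<open>n\<close>.\<close>
  define e where "e = x * Q ^ 0 mod n"
  have eE: "e \<in> E" unfolding E_def cyc_coset_eq_range[OF n Q(1)] e_def by blast
  have EeE: "E = cyc_coset n Q e" using cyc_coset_eqI[OF n Q(1)] eE unfolding E_def by blast
  have de: "d dvd e" unfolding e_def d_def by (simp add: dvd_mod)
  have De: "D dvd e * (Q ^ k - 1)" for k
  proof -
    have "[Q = 1] (mod (Q - 1))" using Q by (simp add: cong_1_iff_dvd del: One_nat_def)
    hence "[Q ^ k = 1] (mod (Q - 1))" using cong_pow by fastforce
    hence "Q - 1 dvd Q ^ k - 1" using Q by (simp add: cong_1_iff_dvd del: One_nat_def)
    hence "g dvd Q ^ k - 1" unfolding g_def by (meson dvd_trans gcd_dvd2)
    thus ?thesis unfolding D_def using de by (intro mult_dvd_mono)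
  qed
  have sub: "E \<subseteq> (\<lambda>i. (e + i * D) mod n) ` {..<s'}"
  proof
    fix y assume "y \<in> E"
    then obtain k where k: "y = e * Q ^ k mod n" unfolding EeE cyc_coset_eq_range[OF n Q(1)] by blast
    obtain i where i: "e * (Q ^ k - 1) = D * i" using De by blast
    have "e * Q ^ k = e + e * (Q ^ k - 1)" using Q by (simp add: algebra_simps)
    also have "\<dots> = e + i * D" using i by simp
    finally show "y \<in> (\<lambda>i. (e + i * D) mod n) ` {..<s'}"
      unfolding progression_eq_range[OF nD n] k by simp
  qed
  have cle: "card ((\<lambda>i. (e + i * D) mod n) ` {..<s'}) \<le> s'"
    using card_image_le[of "{..<s'}"] by simp
  have Eeq: "E = (\<lambda>i. (e + i * D) mod n) ` {..<s'}"
    by (rule card_seteq[OF _ sub]) (use cle le s_def in auto)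
  have ss: "s = s'" using cle le Eeq s_def by simp
  hence "n div s = D" "s dvd n" using nD s'0 by simp_all
  moreover have "E \<subseteq> C" using assms(5) by (simp add: E_def)
  ultimately show ?thesis using eE Eeq
    unfolding equal_diff_subset_def E_def[symmetric] s_def[symmetric] ss[symmetric] by metis
qed

section \<open>Coset sizes, inclusion and refinement\<close>

lemma tau_eq_ord:
  assumes "0 < n" "coprime n q"
  shows "tau n q x = ord (n div gcd x n) q"
proof -
  have "coprime (n div gcd x n) q"
    using assms(2) by (metis coprime_mult_left_iff dvd_div_mult_self gcd_dvd2)
  thus ?thesis
    unfolding tau_eq_period[OF assms] coset_period_def cong_mult_self_iff[OF assms(1)]
    by (simp add: ord_def)
qed

lemma cyc_coset_self:
  assumes "0 < n" "coprime n N" "x < n"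
  shows "x \<in> cyc_coset n N x"
  unfolding cyc_coset_eq_range[OF assms(1,2)]
  using assms(3) by (intro image_eqI[where x = 0]) auto

lemma cyc_coset_less: "0 < n \<Longrightarrow> x \<in> cyc_coset n N y \<Longrightarrow> x < n"
  by (auto simp: cyc_coset_def)

text \<open>Membership asks for \<open>i\<close> with \<open>t * i\<close> congruent to
  \<open>k\<close> modulo \<open>tau n q x\<close>, a linear congruence solvable iff the gcd of
  coefficient and modulus divides \<open>k\<close>.\<close>

lemma power_mem_cyc_coset_power_iff:
  assumes "0 < n" "coprime n q"
  shows "x * q ^ k mod n \<in> cyc_coset n (q ^ t) x \<longleftrightarrow> gcd t (tau n q x) dvd k"
proof -
  define g where "g = gcd t (tau n q x)"
  have cp: "coprime n (q ^ t)" using assms by simp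
  have "x * q ^ k mod n \<in> cyc_coset n (q ^ t) x \<longleftrightarrow> (\<exists>i. [x * q ^ k = x * q ^ (t * i)] (mod n))"
    unfolding cyc_coset_eq_range[OF assms(1) cp] by (auto simp: cong_def power_mult)
  also have "\<dots> \<longleftrightarrow> (\<exists>i. [t * i = k] (mod tau n q x))"
    using power_cong_iff(2)[OF assms, of x] tau_eq_period[OF assms] by (metis cong_sym_eq)
  also have "\<dots> \<longleftrightarrow> g dvd k"
  proof
    assume "\<exists>i. [t * i = k] (mod tau n q x)"
    then obtain i where "[t * i = k] (mod g)"
      using cong_dvd_modulus_nat[of _ _ "tau n q x" g] by (auto simp: g_def)
    moreover have "g dvd t * i" by (simp add: g_def)
    ultimately show "g dvd k" using cong_dvd_iff by blast
  qed (use cong_solve_dvd_nat in \<open>simp add: g_def\<close>)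
  finally show ?thesis unfolding g_def .
qed

lemma cyc_coset_power_subset_iff:
  assumes "0 < n" "coprime n q" "x < n"
  shows "cyc_coset n (q ^ t\<^sub>2) x \<subseteq> cyc_coset n (q ^ t\<^sub>1) x \<longleftrightarrow> gcd t\<^sub>1 (tau n q x) dvd t\<^sub>2"
proof
  assume "cyc_coset n (q ^ t\<^sub>2) x \<subseteq> cyc_coset n (q ^ t\<^sub>1) x"
  moreover have "x * q ^ t\<^sub>2 mod n \<in> cyc_coset n (q ^ t\<^sub>2) x"
    using power_mem_cyc_coset_power_iff[OF assms(1,2)] by simp
  ultimately show "gcd t\<^sub>1 (tau n q x) dvd t\<^sub>2"
    using power_mem_cyc_coset_power_iff[OF assms(1,2)] by blast
next
  assume *: "gcd t\<^sub>1 (tau n q x) dvd t\<^sub>2"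
  have cp: "coprime n (q ^ t\<^sub>2)" using assms by simp
  have "x * q ^ (t\<^sub>2 * k) mod n \<in> cyc_coset n (q ^ t\<^sub>1) x" for k
    unfolding power_mem_cyc_coset_power_iff[OF assms(1,2)] using * by simp
  thus "cyc_coset n (q ^ t\<^sub>2) x \<subseteq> cyc_coset n (q ^ t\<^sub>1) x"
    unfolding cyc_coset_eq_range[OF assms(1) cp] by (auto simp: power_mult)
qed

lemma tau_cyc_coset:
  assumes "0 < n" "coprime n q" "x \<in> cyc_coset n q \<gamma>"
  shows "tau n q x = tau n q \<gamma>"
  unfolding tau_def cyc_coset_eqI[OF assms] ..

text \<open>By \<open>cyc_decomp_eq\<close> the parts are the cosets of all elements of the big
  coset. Refinement therefore compares the two parts through one element, and since
  \<open>tau\<close> is constant on the big coset, the comparison at \<open>\<gamma>\<close> decides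
  all others.\<close>

lemma finer_cyc_decomp_iff:
  assumes n: "0 < n" and q: "coprime n q" and "\<gamma> < n"
  shows "finer (cyc_decomp n q t\<^sub>2 \<gamma>) (cyc_decomp n q t\<^sub>1 \<gamma>) \<longleftrightarrow> gcd t\<^sub>1 (tau n q \<gamma>) dvd t\<^sub>2"
proof
  have cp: "coprime n (q ^ t)" for t using q by simp
  have \<gamma>: "\<gamma> \<in> cyc_coset n q \<gamma>" by (rule cyc_coset_self[OF n q \<open>\<gamma> < n\<close>])
  {
    assume "finer (cyc_decomp n q t\<^sub>2 \<gamma>) (cyc_decomp n q t\<^sub>1 \<gamma>)"
    then obtain J where J: "cyc_decomp n q t\<^sub>2 \<gamma> = (\<Union>E\<in>cyc_decomp n q t\<^sub>1 \<gamma>. J E)"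
      "\<forall>E\<in>cyc_decomp n q t\<^sub>1 \<gamma>. E = \<Union>(J E)" unfolding finer_def by blast
    have "cyc_coset n (q ^ t\<^sub>2) \<gamma> \<in> cyc_decomp n q t\<^sub>2 \<gamma>"
      unfolding cyc_decomp_eq[OF n q] using \<gamma> by blast
    then obtain E where E1: "E \<in> cyc_decomp n q t\<^sub>1 \<gamma>" and "cyc_coset n (q ^ t\<^sub>2) \<gamma> \<in> J E"
      unfolding J(1) by (elim UN_E)
    hence E2: "cyc_coset n (q ^ t\<^sub>2) \<gamma> \<subseteq> E" using J(2) by (metis Union_upper)
    hence "\<gamma> \<in> E" using cyc_coset_self[OF n cp \<open>\<gamma> < n\<close>] by blast
    with E1 have "E = cyc_coset n (q ^ t\<^sub>1) \<gamma>"
      unfolding cyc_decomp_eq[OF n q] using cyc_coset_eqI[OF n cp] by blast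
    thus "gcd t\<^sub>1 (tau n q \<gamma>) dvd t\<^sub>2"
      using E2 cyc_coset_power_subset_iff[OF n q \<open>\<gamma> < n\<close>] by simp
  }
  assume dvd: "gcd t\<^sub>1 (tau n q \<gamma>) dvd t\<^sub>2"
  \<comment> \<open>Fine parts are grouped by inclusion. The groups are disjoint because fine parts
    are nonempty and distinct coarse parts do not meet.\<close>
  define J where "J E = {F \<in> cyc_decomp n q t\<^sub>2 \<gamma>. F \<subseteq> E}" for E
  have sub: "cyc_coset n (q ^ t\<^sub>2) x \<subseteq> cyc_coset n (q ^ t\<^sub>1) x" if "x \<in> cyc_coset n q \<gamma>" for x
    using cyc_coset_power_subset_iff[OF n q cyc_coset_less[OF n that]]
      tau_cyc_coset[OF n q that] dvd by simp
  have "cyc_decomp n q t\<^sub>2 \<gamma> = (\<Union>E\<in>cyc_decomp n q t\<^sub>1 \<gamma>. J E)"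
    unfolding J_def using sub unfolding cyc_decomp_eq[OF n q] by blast
  moreover have "E = \<Union>(J E)" if "E \<in> cyc_decomp n q t\<^sub>1 \<gamma>" for E
  proof
    show "E \<subseteq> \<Union>(J E)"
    proof
      fix x assume x: "x \<in> E"
      have xC: "x \<in> cyc_coset n q \<gamma>" using x that cyc_decomp_Union[OF n q] by blast
      have "E = cyc_coset n (q ^ t\<^sub>1) x"
        using x that cyc_coset_eqI[OF n cp] unfolding cyc_decomp_eq[OF n q] by blast
      hence "cyc_coset n (q ^ t\<^sub>2) x \<in> J E"
        using sub[OF xC] xC unfolding J_def cyc_decomp_eq[OF n q] by blast
      moreover have "x \<in> cyc_coset n (q ^ t\<^sub>2) x"
        by (rule cyc_coset_self[OF n cp cyc_coset_less[OF n xC]])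
      ultimately show "x \<in> \<Union>(J E)" by blast
    qed
  qed (auto simp: J_def)
  moreover have "disjoint_family_on J (cyc_decomp n q t\<^sub>1 \<gamma>)"
    unfolding disjoint_family_on_def
  proof (intro ballI impI)
    fix E E' assume E: "E \<in> cyc_decomp n q t\<^sub>1 \<gamma>" "E' \<in> cyc_decomp n q t\<^sub>1 \<gamma>" "E \<noteq> E'"
    have "E \<inter> E' = {}"
      using E cyc_coset_eqI[OF n cp] unfolding cyc_decomp_eq[OF n q] by blast
    moreover have "F \<noteq> {}" if "F \<in> cyc_decomp n q t\<^sub>2 \<gamma>" for F
      using that cyc_coset_self[OF n cp cyc_coset_less[OF n]] unfolding cyc_decomp_eq[OF n q] by blast
    ultimately show "J E \<inter> J E' = {}" unfolding J_def by blast
  qed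
  ultimately show "finer (cyc_decomp n q t\<^sub>2 \<gamma>) (cyc_decomp n q t\<^sub>1 \<gamma>)"
    unfolding finer_def by blast
qed

lemma cyc_decomp_eq_iff:
  assumes n: "0 < n" and q: "coprime n q" and "\<gamma> < n"
  shows "cyc_decomp n q t\<^sub>1 \<gamma> = cyc_decomp n q t\<^sub>2 \<gamma> \<longleftrightarrow> gcd t\<^sub>1 (tau n q \<gamma>) = gcd t\<^sub>2 (tau n q \<gamma>)"
proof
  assume "cyc_decomp n q t\<^sub>1 \<gamma> = cyc_decomp n q t\<^sub>2 \<gamma>"
  hence "gcd t\<^sub>1 (tau n q \<gamma>) dvd t\<^sub>2" "gcd t\<^sub>2 (tau n q \<gamma>) dvd t\<^sub>1"
    using finer_cyc_decomp_iff[OF assms] by (metis gcd_dvd1)+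
  thus "gcd t\<^sub>1 (tau n q \<gamma>) = gcd t\<^sub>2 (tau n q \<gamma>)"
    by (intro dvd_antisym gcd_greatest) auto
next
  assume *: "gcd t\<^sub>1 (tau n q \<gamma>) = gcd t\<^sub>2 (tau n q \<gamma>)"
  have "cyc_coset n (q ^ t\<^sub>1) x = cyc_coset n (q ^ t\<^sub>2) x" if "x \<in> cyc_coset n q \<gamma>" for x
    using cyc_coset_power_subset_iff[OF n q cyc_coset_less[OF n that]] tau_cyc_coset[OF n q that] *
    by (metis gcd_dvd1 subset_antisym)
  thus "cyc_decomp n q t\<^sub>1 \<gamma> = cyc_decomp n q t\<^sub>2 \<gamma>"
    unfolding cyc_decomp_eq[OF n q] by (rule image_cong[OF refl])
qed

section \<open>Multiple equal-difference representations\<close>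

lemma cyc_decomp_mem_MER_iff:
  assumes n: "0 < n" and q: "coprime n q" "0 < q" and \<gamma>: "\<gamma> < n" and t: "1 \<le> t"
  shows "cyc_decomp n q t \<gamma> \<in> MER n q \<gamma> \<longleftrightarrow> omega (n div gcd \<gamma> n) q dvd t"
proof -
  have cp: "coprime n (q ^ t)" using q by simp
  define m where "m = n div gcd \<gamma> n"
  have nm: "n = m * gcd \<gamma> n" by (simp add: m_def)
  have m: "0 < m" "coprime m q" using n q nm by (metis mult_0 not_gr0, metis coprime_mult_left_iff)
  have part: "partition_on (cyc_coset n q \<gamma>) (cyc_decomp n q t \<gamma>)"
  proof (rule partition_onI)
    show "\<Union>(cyc_decomp n q t \<gamma>) = cyc_coset n q \<gamma>" by (rule cyc_decomp_Union[OF n q(1)])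
    show "disjnt E E'" if "E \<in> cyc_decomp n q t \<gamma>" "E' \<in> cyc_decomp n q t \<gamma>" "E \<noteq> E'" for E E'
      using that cyc_coset_eqI[OF n cp] unfolding cyc_decomp_eq[OF n q(1)] disjnt_def by blast
    show "{} \<notin> cyc_decomp n q t \<gamma>"
      using cyc_coset_self[OF n cp cyc_coset_less[OF n]] unfolding cyc_decomp_eq[OF n q(1)] by blast
  qed
  \<comment> \<open>The gcd with \<open>n\<close> is constant on the coset, so one condition on
    \<open>q ^ t\<close> governs every part.\<close>
  have "equal_diff_subset n (cyc_coset n q \<gamma>) (cyc_coset n (q ^ t) x) \<longleftrightarrow> liftable m (q ^ t)"
    if x: "x \<in> cyc_coset n q \<gamma>" for x
  proof -
    have "n div gcd x n = m" using gcd_cyc_coset[OF n q(1) x] by (simp add: m_def)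
    moreover have "cyc_coset n (q ^ t) x \<subseteq> cyc_coset n q \<gamma>"
      using cyc_decomp_Union[OF n q(1), of t \<gamma>] x unfolding cyc_decomp_eq[OF n q(1)] by blast
    ultimately show ?thesis
      using equal_diff_cyc_coset_imp_liftable[OF n cp] liftable_imp_equal_diff_cyc_coset[OF n cp] q(2)
      by (metis zero_less_power)
  qed
  hence "(\<forall>E\<in>cyc_decomp n q t \<gamma>. equal_diff_subset n (cyc_coset n q \<gamma>) E) \<longleftrightarrow> liftable m (q ^ t)"
    using cyc_coset_self[OF n q(1) \<gamma>] unfolding cyc_decomp_eq[OF n q(1)] by blast
  thus ?thesis using part t
    unfolding MER_def equal_diff_decomp_def omega_dvd_iff[OF m] m_def[symmetric] by blast
qed

section \<open>The two order-reversing bijections\<close>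

lemma liftable_of_cong_1: "[Q = 1] (mod m) \<Longrightarrow> liftable m Q"
  unfolding liftable_def
proof (intro conjI allI impI notI; (elim conjE)?)
  assume Q: "[Q = 1] (mod m)"
  show "[Q = 1] (mod p)" if "p dvd m" for p using Q that by (rule cong_dvd_modulus_nat)
  assume "8 dvd m" and Q3: "[Q = 3] (mod 4)"
  have "(4::nat) dvd 8" by simp
  hence "[Q = 1] (mod 4)" using Q \<open>8 dvd m\<close> by (meson cong_dvd_modulus_nat dvd_trans)
  thus False using Q3 by (simp add: cong_def)
qed

text \<open>Ensures that replacing \<open>t\<close> by its gcd with the order keeps divisibility by
  \<open>omega\<close>.\<close>

lemma omega_dvd_ord:
  assumes "0 < m" "coprime m q"
  shows "omega m q dvd ord m q"
  unfolding omega_dvd_iff[OF assms] by (intro liftable_of_cong_1 ord)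

text \<open>Common skeleton of both bijections. A value \<open>f t\<close> in \<open>M\<close> is
  also attained at \<open>gcd t \<tau>\<close>, which divides \<open>\<tau>\<close> and remains a
  multiple of \<open>\<omega>\<close>.\<close>

lemma bij_betw_Sigma_div:
  assumes "0 < \<tau>" "\<omega> dvd \<tau>"
    and eq: "\<And>t. f (gcd t \<tau>) = f t"
    and inj: "\<And>s t. s dvd \<tau> \<Longrightarrow> t dvd \<tau> \<Longrightarrow> f s = f t \<Longrightarrow> s = t"
    and mem: "\<And>t. 1 \<le> t \<Longrightarrow> f t \<in> M \<longleftrightarrow> \<omega> dvd t"
    and ex: "\<And>y. y \<in> M \<Longrightarrow> \<exists>t\<ge>1. y = f t"
  shows "bij_betw f (Sigma_div \<tau> \<omega>) M"
  unfolding bij_betw_def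
proof (intro conjI equalityI subsetI)
  show "inj_on f (Sigma_div \<tau> \<omega>)" using inj by (auto simp: inj_on_def Sigma_div_def)
next
  fix y assume "y \<in> f ` Sigma_div \<tau> \<omega>"
  then obtain t where t: "t dvd \<tau>" "\<omega> dvd t" "y = f t" by (auto simp: Sigma_div_def)
  have "1 \<le> t" using t(1) assms(1) by (cases "t = 0") auto
  thus "y \<in> M" using t mem by simp
next
  fix y assume "y \<in> M"
  then obtain t where t: "t \<ge> 1" "y = f t" using ex by blast
  hence "\<omega> dvd t" using mem \<open>y \<in> M\<close> by simp
  hence "gcd t \<tau> \<in> Sigma_div \<tau> \<omega>" using assms(2) by (simp add: Sigma_div_def)
  thus "y \<in> f ` Sigma_div \<tau> \<omega>" using eq t(2) by (metis image_eqI)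
qed

lemma cyc_decomp_tuple_eq_iff:
  assumes "0 < n" "coprime n q"
  shows "cyc_decomp_tuple n q s = cyc_decomp_tuple n q t \<longleftrightarrow>
    (\<forall>\<gamma><n. gcd s (tau n q \<gamma>) = gcd t (tau n q \<gamma>))"
proof -
  have "cyc_decomp_tuple n q s = cyc_decomp_tuple n q t \<longleftrightarrow>
      (\<forall>C\<in>cyc_cosets n q. cyc_decomp_tuple n q s C = cyc_decomp_tuple n q t C)"
    unfolding cyc_decomp_tuple_def by (auto simp: fun_eq_iff restrict_def)
  also have "\<dots> \<longleftrightarrow> (\<forall>\<gamma><n. cyc_decomp n q s \<gamma> = cyc_decomp n q t \<gamma>)"
    using cyc_decomp_tuple_coset[OF assms] by (auto simp: cyc_cosets_def)
  finally show ?thesis using cyc_decomp_eq_iff[OF assms] by simp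
qed

theorem theorem4p2:
  fixes q n :: nat
  assumes "primepow q" and "0 < n" and "coprime n q"
  shows
    "(\<forall>\<gamma><n.
        let \<Sigma> = Sigma_div (tau n q \<gamma>) (omega (n div gcd \<gamma> n) q);
            \<phi> = (\<lambda>t. (\<lambda>j. cyc_coset n (q ^ t) (\<gamma> * q ^ j mod n)) ` {..<t})
        in bij_betw \<phi> \<Sigma> (MER n q \<gamma>) \<and>
           (\<forall>t\<^sub>1\<in>\<Sigma>. \<forall>t\<^sub>2\<in>\<Sigma>. t\<^sub>1 dvd t\<^sub>2 \<longleftrightarrow> finer (\<phi> t\<^sub>2) (\<phi> t\<^sub>1))) \<and>
     (let \<Sigma> = Sigma_div (ord n q) (omega n q);
          \<phi> = cyc_decomp_tuple n q
      in bij_betw \<phi> \<Sigma> (MER_tuples n q) \<and>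
         (\<forall>t\<^sub>1\<in>\<Sigma>. \<forall>t\<^sub>2\<in>\<Sigma>. t\<^sub>1 dvd t\<^sub>2 \<longleftrightarrow> finer_tuple n q (\<phi> t\<^sub>2) (\<phi> t\<^sub>1)))"
proof -
  note n = \<open>0 < n\<close> and q = \<open>coprime n q\<close>
  have q0: "0 < q" using assms(1) by (rule primepow_gt_0_nat)
  have m: "0 < n div gcd \<gamma> n" "coprime (n div gcd \<gamma> n) q" "n div gcd \<gamma> n dvd n" for \<gamma>
  proof -
    have "n = (n div gcd \<gamma> n) * gcd \<gamma> n" by simp
    thus "0 < n div gcd \<gamma> n" "coprime (n div gcd \<gamma> n) q" "n div gcd \<gamma> n dvd n"
      using n q by (metis mult_0 not_gr0, metis coprime_mult_left_iff, metis dvd_triv_left)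
  qed
  have tau0: "0 < tau n q \<gamma>" for \<gamma>
    using m by (simp add: tau_eq_ord[OF n q] ord_gt_0_iff)
  have tau_dvd: "tau n q \<gamma> dvd ord n q" for \<gamma>
    unfolding tau_eq_ord[OF n q] ord_divides[symmetric]
    using cong_dvd_modulus_nat[OF ord m(3)] .
  \<comment> \<open>The class of 1, reduced so that \<open>n = 1\<close> is covered. Its coset has
    size \<open>ord n q\<close> and its reduced modulus is \<open>n\<close> itself, so this
    component of a tuple determines a divisor \<open>t\<close> of \<open>ord n q\<close>.\<close>
  define \<epsilon> where "\<epsilon> = 1 mod n"
  have \<epsilon>: "\<epsilon> < n" "gcd \<epsilon> n = 1" using n by (auto simp: \<epsilon>_def gcd_mod_left)
  have tau_\<epsilon>: "tau n q \<epsilon> = ord n q" by (simp add: tau_eq_ord[OF n q] \<epsilon>)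

  have comp: "bij_betw (\<lambda>t. (\<lambda>j. cyc_coset n (q ^ t) (\<gamma> * q ^ j mod n)) ` {..<t})
        (Sigma_div (tau n q \<gamma>) (omega (n div gcd \<gamma> n) q)) (MER n q \<gamma>) \<and>
      (\<forall>t\<^sub>1\<in>Sigma_div (tau n q \<gamma>) (omega (n div gcd \<gamma> n) q).
       \<forall>t\<^sub>2\<in>Sigma_div (tau n q \<gamma>) (omega (n div gcd \<gamma> n) q).
        t\<^sub>1 dvd t\<^sub>2 \<longleftrightarrow> finer ((\<lambda>j. cyc_coset n (q ^ t\<^sub>2) (\<gamma> * q ^ j mod n)) ` {..<t\<^sub>2})
          ((\<lambda>j. cyc_coset n (q ^ t\<^sub>1) (\<gamma> * q ^ j mod n)) ` {..<t\<^sub>1}))"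
    (is "bij_betw ?\<phi> ?\<Sigma> _ \<and> _") if \<gamma>: "\<gamma> < n" for \<gamma>
  proof -
    have gcd: "gcd t (tau n q \<gamma>) = t" if "t dvd tau n q \<gamma>" for t
      using that by (simp add: gcd_proj1_iff)
    \<comment> \<open>For divisors of \<open>tau n q \<gamma>\<close> the index bound
      \<open>t\<close> equals the gcd used in \<open>cyc_decomp\<close>.\<close>
    hence \<phi>: "?\<phi> t = cyc_decomp n q t \<gamma>" if "t \<in> ?\<Sigma>" for t
      using that by (simp add: Sigma_div_def cyc_decomp_def)
    have "bij_betw (\<lambda>t. cyc_decomp n q t \<gamma>) ?\<Sigma> (MER n q \<gamma>)"
    proof (rule bij_betw_Sigma_div)
      show "omega (n div gcd \<gamma> n) q dvd tau n q \<gamma>"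
        unfolding tau_eq_ord[OF n q] by (intro omega_dvd_ord m)
      show "cyc_decomp n q (gcd t (tau n q \<gamma>)) \<gamma> = cyc_decomp n q t \<gamma>" for t
        unfolding cyc_decomp_eq_iff[OF n q \<gamma>] by simp
      show "s = t" if "s dvd tau n q \<gamma>" "t dvd tau n q \<gamma>"
        "cyc_decomp n q s \<gamma> = cyc_decomp n q t \<gamma>" for s t
        using that unfolding cyc_decomp_eq_iff[OF n q \<gamma>] by (simp add: gcd)
      show "\<exists>t\<ge>1. y = cyc_decomp n q t \<gamma>" if "y \<in> MER n q \<gamma>" for y
        using that by (simp add: MER_def)
    qed (use tau0 cyc_decomp_mem_MER_iff[OF n q q0 \<gamma>] in auto)
    hence "bij_betw ?\<phi> ?\<Sigma> (MER n q \<gamma>)"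
      using \<phi> by (subst bij_betw_cong) auto
    moreover have "t\<^sub>1 dvd t\<^sub>2 \<longleftrightarrow> finer (?\<phi> t\<^sub>2) (?\<phi> t\<^sub>1)" if "t\<^sub>1 \<in> ?\<Sigma>" "t\<^sub>2 \<in> ?\<Sigma>" for t\<^sub>1 t\<^sub>2
      unfolding \<phi>[OF that(1)] \<phi>[OF that(2)] finer_cyc_decomp_iff[OF n q \<gamma>]
      using that by (simp add: Sigma_div_def gcd)
    ultimately show ?thesis by blast
  qed

  have gcd: "gcd t (ord n q) = t" if "t dvd ord n q" for t
    using that by (simp add: gcd_proj1_iff)
  have "bij_betw (cyc_decomp_tuple n q) (Sigma_div (ord n q) (omega n q)) (MER_tuples n q)"
  proof (rule bij_betw_Sigma_div)
    show "0 < ord n q" using tau0 tau_\<epsilon> by metis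
    show "omega n q dvd ord n q" by (rule omega_dvd_ord[OF n q])
    show "cyc_decomp_tuple n q (gcd t (ord n q)) = cyc_decomp_tuple n q t" for t
      unfolding cyc_decomp_tuple_eq_iff[OF n q]
    proof (intro allI impI)
      fix \<gamma> assume "\<gamma> < n"
      have "gcd (ord n q) (tau n q \<gamma>) = tau n q \<gamma>" using tau_dvd by (simp add: gcd_proj2_iff)
      thus "gcd (gcd t (ord n q)) (tau n q \<gamma>) = gcd t (tau n q \<gamma>)" by (simp add: gcd.assoc)
    qed
    show "s = t" if "s dvd ord n q" "t dvd ord n q"
      "cyc_decomp_tuple n q s = cyc_decomp_tuple n q t" for s t
      using that \<epsilon>(1) tau_\<epsilon> gcd unfolding cyc_decomp_tuple_eq_iff[OF n q] by metis
    show "cyc_decomp_tuple n q t \<in> MER_tuples n q \<longleftrightarrow> omega n q dvd t" if t: "1 \<le> t" for t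
    proof -
      have "cyc_decomp_tuple n q t \<in> MER_tuples n q \<longleftrightarrow>
          (\<forall>\<gamma><n. omega (n div gcd \<gamma> n) q dvd t)"
        using t cyc_decomp_mem_MER_iff[OF n q q0 _ t] cyc_decomp_tuple_coset[OF n q]
        by (auto simp: MER_tuples_def)
      also have "\<dots> \<longleftrightarrow> omega n q dvd t"
      proof
        assume "\<forall>\<gamma><n. omega (n div gcd \<gamma> n) q dvd t"
        thus "omega n q dvd t" using \<epsilon> by (metis div_by_1)
      next
        assume "omega n q dvd t"
        \<comment> \<open>\<open>liftable\<close> passes to divisors of the modulus, which avoids
          comparing values of \<open>omega\<close>.\<close>
        hence "liftable n (q ^ t)" by (simp add: omega_dvd_iff[OF n q])
        hence "liftable (n div gcd \<gamma> n) (q ^ t)" for \<gamma>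
          using m(3)[of \<gamma>] unfolding liftable_def by (meson dvd_trans)
        thus "\<forall>\<gamma><n. omega (n div gcd \<gamma> n) q dvd t" by (simp add: omega_dvd_iff[OF m(1,2)])
      qed
      finally show ?thesis .
    qed
    show "\<exists>t\<ge>1. F = cyc_decomp_tuple n q t" if "F \<in> MER_tuples n q" for F
      using that by (simp add: MER_tuples_def)
  qed
  moreover have "t\<^sub>1 dvd t\<^sub>2 \<longleftrightarrow> finer_tuple n q (cyc_decomp_tuple n q t\<^sub>2) (cyc_decomp_tuple n q t\<^sub>1)"
    if "t\<^sub>1 dvd ord n q" for t\<^sub>1 t\<^sub>2
  proof -
    have "finer_tuple n q (cyc_decomp_tuple n q t\<^sub>2) (cyc_decomp_tuple n q t\<^sub>1) \<longleftrightarrow>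
        (\<forall>\<gamma><n. gcd t\<^sub>1 (tau n q \<gamma>) dvd t\<^sub>2)"
      using cyc_decomp_tuple_coset[OF n q] finer_cyc_decomp_iff[OF n q]
      by (auto simp: finer_tuple_def cyc_cosets_def)
    \<comment> \<open>The component at \<open>\<epsilon>\<close> already gives the forward
      direction, since there the gcd is \<open>t\<^sub>1\<close>.\<close>
    also have "\<dots> \<longleftrightarrow> t\<^sub>1 dvd t\<^sub>2"
      using \<epsilon>(1) tau_\<epsilon> gcd[OF that] by (metis dvd_trans gcd_dvd1)
    finally show ?thesis ..
  qed
  hence "\<forall>t\<^sub>1\<in>Sigma_div (ord n q) (omega n q). \<forall>t\<^sub>2\<in>Sigma_div (ord n q) (omega n q).
      t\<^sub>1 dvd t\<^sub>2 \<longleftrightarrow> finer_tuple n q (cyc_decomp_tuple n q t\<^sub>2) (cyc_decomp_tuple n q t\<^sub>1)"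
    by (simp add: Sigma_div_def)
  ultimately show ?thesis using comp unfolding Let_def by blast
qed

end
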